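(* Let $c_n=\big(\prod_{i=1}^{n-1}i!\big)^{-1}$, $\Delta_n(\mathbf{x})=\prod_{1\le i<j\le n}(x_i-x_j)$ and $\mathbf{1}_n=(1,\dots,1)\in\mathbf{R}^n$. Suppose that $u$ is a continuous real-valued function on $\mathbf{R}\times\mathbf{R}$ such that, for every $n\ge1$, the function $$(\mathbf{x},\mathbf{y})\mapsto\frac{\det[u(x_i,y_j)]_{i,j=1}^n}{\Delta_n(\mathbf{x})\Delta_n(\mathbf{y})},$$ defined for $\mathbf{x},\mathbf{y}\in\mathbf{R}^n$ each having distinct coordinates, extends to a strictly positive, continuous function $M_n$ on $\mathbf{R}^n\times\mathbf{R}^n$. Define, for $n\ge1$, $$\tau_n(x,y)=c_n^{-2}M_n(x\mathbf{1}_n,y\mathbf{1}_n),\qquad x,y\in\mathbf{R},$$ and $\tau_0(x,y)=1$. Then $(\tau_n;n\ge1)$ satisfy the two-dimensional Toda equations in integrated form: for every $n\ge1$ and all $a,b,c,d\in\mathbf{R}$, $$\log\left(\frac{\tau_n(a,c)\,\tau_n(b,d)}{\tau_n(a,d)\,\tau_n(b,c)}\right)=\int_a^b\int_c^d\frac{\tau_{n-1}(x,y)\,\tau_{n+1}(x,y)}{\tau_n(x,y)^2}\,\mathrm{d}y\,\mathrm{d}x.$$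
   Context: An empty product equals $1$, so $c_1=1$ and $\Delta_1\equiv1$. *)

theory Defs
  imports
    "HOL-Analysis.Abstract_Euclidean_Space"
    "HOL-Analysis.Interval_Integral"
    "Jordan_Normal_Form.Determinant"
begin

(* Since the dimension n varies, points of R^n are the elements of
   topspace (Euclidean_space n), i.e. the functions x :: nat => real with x i = 0 for
   all i >= n. Coordinates are numbered 0, ..., n - 1. *)

definition scaled_ones :: "nat \<Rightarrow> real \<Rightarrow> nat \<Rightarrow> real" where
  "scaled_ones n t = (\<lambda>i. if i < n then t else 0)"

definition superfactorial_const :: "nat \<Rightarrow> real" where
  "superfactorial_const n = inverse (\<Prod>i=1..n-1. fact i)"

definition Vandermonde :: "nat \<Rightarrow> (nat \<Rightarrow> real) \<Rightarrow> real" where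
  "Vandermonde n x = (\<Prod>(i, j)\<in>{(i, j). i < j \<and> j < n}. x i - x j)"

definition kernel_det :: "(real \<times> real \<Rightarrow> real) \<Rightarrow> nat \<Rightarrow> (nat \<Rightarrow> real) \<Rightarrow> (nat \<Rightarrow> real) \<Rightarrow> real" where
  "kernel_det u n x y = Determinant.det (Matrix.mat n n (\<lambda>(i, j). u (x i, y j)))"

(* N is determined by u and n: pairs of points with distinct coordinates are dense. *)
definition is_positive_extension ::
    "(real \<times> real \<Rightarrow> real) \<Rightarrow> nat \<Rightarrow> ((nat \<Rightarrow> real) \<times> (nat \<Rightarrow> real) \<Rightarrow> real) \<Rightarrow> bool" where
  "is_positive_extension u n N \<longleftrightarrow>
     continuous_map (prod_topology (Euclidean_space n) (Euclidean_space n)) euclideanreal N \<and>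
     (\<forall>x\<in>topspace (Euclidean_space n). \<forall>y\<in>topspace (Euclidean_space n). 0 < N (x, y)) \<and>
     (\<forall>x\<in>topspace (Euclidean_space n). \<forall>y\<in>topspace (Euclidean_space n).
        inj_on x {..<n} \<longrightarrow> inj_on y {..<n} \<longrightarrow>
        N (x, y) = kernel_det u n x y / (Vandermonde n x * Vandermonde n y))"

definition toda_tau ::
    "(nat \<Rightarrow> (nat \<Rightarrow> real) \<times> (nat \<Rightarrow> real) \<Rightarrow> real) \<Rightarrow> nat \<Rightarrow> real \<Rightarrow> real \<Rightarrow> real" where
  "toda_tau M n x y =
     (if n = 0 then 1
      else superfactorial_const n powi (-2) * M n (scaled_ones n x, scaled_ones n y))"

end

theory Submission
  imports Defs
begin

text \<open>
  Sylvester's identity for the matrix \<open>u (x i, y j)\<close> bordered by two rows \<open>a, b\<close> and two columns \<open>c, d\<close>,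
  divided by the Vandermonde factors and extended by continuity, reads
  \<open>(a - b)(c - d) M\<^sub>m\<^sub>+\<^sub>2(xab; ycd) M\<^sub>m(x; y) = M\<^sub>m\<^sub>+\<^sub>1(xa; yc) M\<^sub>m\<^sub>+\<^sub>1(xb; yd) - M\<^sub>m\<^sub>+\<^sub>1(xa; yd) M\<^sub>m\<^sub>+\<^sub>1(xb; yc)\<close>.
  Hence the mixed difference of \<open>ln M\<^sub>m\<^sub>+\<^sub>1\<close> in one coordinate of each argument is
  \<open>ln (1 + (b - a)(d - c) \<rho>)\<close> with \<open>\<rho>\<close> continuous. Moving the \<open>n\<close> coordinates of \<open>a 1\<^sub>n\<close> to \<open>b\<close> one at a
  time, and likewise from \<open>c\<close> to \<open>d\<close>, writes the mixed difference of \<open>ln \<tau>\<^sub>n\<close> as a sum of \<open>n\<^sup>2\<close> such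
  terms. Letting first \<open>b \<rightarrow> a\<close> and then \<open>d \<rightarrow> c\<close> shows that it has the mixed derivative \<open>n\<^sup>2 \<rho>\<close>, where
  the \<open>n\<^sup>2\<close> is exactly the quotient of the constants \<open>c\<^sub>n\<close>. Only the existence of iterated derivatives
  of differences is needed, so no smoothness of \<open>u\<close> enters, and the fundamental theorem of calculus
  applies twice.
\<close>

section \<open>Sylvester's identity for kernel determinants\<close>

lemma det_block_LU:
  fixes A :: "'a :: idom mat"
  assumes A: "A \<in> carrier_mat n n" and C: "C \<in> carrier_mat k n"
    and E: "E \<in> carrier_mat n k" and S: "S \<in> carrier_mat k k"
  shows "Determinant.det (four_block_mat A (A * E) C (C * E + S)) = Determinant.det A * Determinant.det S"
proof -
  have [simp]: "A * E \<in> carrier_mat n k" "C * E \<in> carrier_mat k k"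
    using A C E by auto
  have "four_block_mat A (0\<^sub>m n k) C (1\<^sub>m k) * four_block_mat (1\<^sub>m n) E (0\<^sub>m k n) S =
      four_block_mat (A * 1\<^sub>m n + 0\<^sub>m n k * 0\<^sub>m k n) (A * E + 0\<^sub>m n k * S)
        (C * 1\<^sub>m n + 1\<^sub>m k * 0\<^sub>m k n) (C * E + 1\<^sub>m k * S)"
    by (rule mult_four_block_mat[OF A zero_carrier_mat C one_carrier_mat one_carrier_mat E zero_carrier_mat S])
  then have "four_block_mat A (A * E) C (C * E + S) =
      four_block_mat A (0\<^sub>m n k) C (1\<^sub>m k) * four_block_mat (1\<^sub>m n) E (0\<^sub>m k n) S"
    by (simp add: right_mult_one_mat[OF A] right_mult_one_mat[OF C] left_mult_one_mat[OF S] left_mult_zero_mat[OF S]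
        left_mult_zero_mat[OF zero_carrier_mat] left_mult_one_mat[OF zero_carrier_mat]
        right_add_zero_mat[OF A] right_add_zero_mat[OF C] right_add_zero_mat[of "A * E"])
  also have "Determinant.det \<dots> =
      Determinant.det (four_block_mat A (0\<^sub>m n k) C (1\<^sub>m k)) * Determinant.det (four_block_mat (1\<^sub>m n) E (0\<^sub>m k n) S)"
    by (rule det_mult[where n = "n + k"]) (intro four_block_carrier_mat A S one_carrier_mat)+
  also have "\<dots> = Determinant.det A * Determinant.det S"
    by (simp add: det_four_block_mat_upper_right_zero[OF A refl C one_carrier_mat]
        det_four_block_mat_lower_left_zero[OF one_carrier_mat E refl S])
  finally show ?thesis .
qed

text \<open>This is \<open>det_block_LU\<close> with \<open>E = A' * B\<close> and
  \<open>S = D - C * E\<close>, since then \<open>A * E = B\<close>.\<close>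

lemma det_Schur_complement:
  fixes A :: "'a :: field mat"
  assumes A: "A \<in> carrier_mat n n" and B: "B \<in> carrier_mat n k"
    and C: "C \<in> carrier_mat k n" and D: "D \<in> carrier_mat k k"
    and A': "A' \<in> carrier_mat n n" and inv: "A * A' = 1\<^sub>m n"
  shows "Determinant.det (four_block_mat A B C D) = Determinant.det A * Determinant.det (D - C * (A' * B))"
proof -
  have E: "A' * B \<in> carrier_mat n k" and CE: "C * (A' * B) \<in> carrier_mat k k"
    using A' B C by auto
  have "X + (D - X) = D" if "X \<in> carrier_mat k k" for X
    using that D by (intro eq_matI) auto
  moreover have "A * (A' * B) = B"
    using A A' B inv by (metis assoc_mult_mat left_mult_one_mat)
  ultimately show ?thesis
    using det_block_LU[OF A C E minus_carrier_mat[OF CE, of D]] CE by simp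
qed

lemma det_nonzero_right_inverse:
  fixes A :: "'a :: field mat"
  assumes A: "A \<in> carrier_mat n n" and "Determinant.det A \<noteq> 0"
  obtains A' where "A' \<in> carrier_mat n n" "A * A' = 1\<^sub>m n"
  \<comment> \<open>\<open>undefined\<close> fills the record extension of
    \<open>ring_mat\<close>.\<close>
  using det_non_zero_imp_unit[OF assms, of undefined]
  by (auto simp: Units_def ring_mat_simps)

text \<open>The bordered determinants are again determinants of a kernel, the Schur complement \<open>s\<close> of
  the matrix \<open>u (x i, y j)\<close>.\<close>

lemma kernel_det_bordered:
  assumes nz: "kernel_det u m x y \<noteq> 0"
  obtains s where "\<And>k x' y'. (\<And>i. i < m \<Longrightarrow> x' i = x i) \<Longrightarrow> (\<And>i. i < m \<Longrightarrow> y' i = y i) \<Longrightarrow>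
    kernel_det u (m + k) x' y' = kernel_det u m x y * kernel_det s k (\<lambda>i. x' (m + i)) (\<lambda>i. y' (m + i))"
proof -
  define A where "A = Matrix.mat m m (\<lambda>(i, j). u (x i, y j))"
  have A: "A \<in> carrier_mat m m" by (simp add: A_def)
  obtain A' where A': "A' \<in> carrier_mat m m" "A * A' = 1\<^sub>m m"
    using det_nonzero_right_inverse[OF A] nz unfolding kernel_det_def A_def by auto
  \<comment> \<open>The entries of \<open>D - C * (A' * B)\<close> depend only on the bordering
    points \<open>p\<close> and \<open>q\<close>, so a single \<open>s\<close> serves every
    \<open>k\<close>, \<open>x'\<close> and \<open>y'\<close>.\<close>
  define s where "s = (\<lambda>(p, q). u (p, q) -
    Matrix.vec m (\<lambda>j. u (p, y j)) \<bullet> (A' *\<^sub>v Matrix.vec m (\<lambda>i. u (x i, q))))"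
  show ?thesis
  proof (rule that[of s])
    fix k and x' y' :: "nat \<Rightarrow> real"
    assume x': "\<And>i. i < m \<Longrightarrow> x' i = x i" and y': "\<And>i. i < m \<Longrightarrow> y' i = y i"
    define B where "B = Matrix.mat m k (\<lambda>(i, j). u (x i, y' (m + j)))"
    define C where "C = Matrix.mat k m (\<lambda>(i, j). u (x' (m + i), y j))"
    define D where "D = Matrix.mat k k (\<lambda>(i, j). u (x' (m + i), y' (m + j)))"
    have "Matrix.mat (m + k) (m + k) (\<lambda>(i, j). u (x' i, y' j)) = four_block_mat A B C D"
      by (intro eq_matI) (auto simp: A_def B_def C_def D_def x' y')
    moreover have "D - C * (A' * B) = Matrix.mat k k (\<lambda>(i, j). s (x' (m + i), y' (m + j)))"
    proof (intro eq_matI)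
      fix i j assume ij: "i < dim_row (Matrix.mat k k (\<lambda>(i, j). s (x' (m + i), y' (m + j))))"
        "j < dim_col (Matrix.mat k k (\<lambda>(i, j). s (x' (m + i), y' (m + j))))"
      have "Matrix.col B j = Matrix.vec m (\<lambda>i. u (x i, y' (m + j)))"
        "Matrix.row C i = Matrix.vec m (\<lambda>j. u (x' (m + i), y j))"
        using ij by (auto simp: B_def C_def)
      moreover have "Matrix.col (A' * B) j = A' *\<^sub>v Matrix.col B j"
        using A' ij by (intro col_mult2[where n = m and nc = k]) (auto simp: B_def)
      ultimately show "(D - C * (A' * B)) $$ (i, j) = Matrix.mat k k (\<lambda>(i, j). s (x' (m + i), y' (m + j))) $$ (i, j)"
        using A' ij by (simp add: B_def C_def D_def s_def)
    qed (use A' in \<open>auto simp: B_def C_def D_def\<close>)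
    ultimately show "kernel_det u (m + k) x' y' =
        kernel_det u m x y * kernel_det s k (\<lambda>i. x' (m + i)) (\<lambda>i. y' (m + i))"
      unfolding kernel_det_def A_def[symmetric]
      using det_Schur_complement[of A m B k C D A'] A A'
      by (simp add: B_def C_def D_def)
  qed
qed

lemma kernel_det_0 [simp]: "kernel_det u 0 x y = 1"
  by (simp add: kernel_det_def)

lemma kernel_det_1: "kernel_det u (Suc 0) x y = u (x 0, y 0)"
  unfolding kernel_det_def by (subst det_single) auto

lemma kernel_det_2:
  "kernel_det u (Suc (Suc 0)) x y = u (x 0, y 0) * u (x 1, y 1) - u (x 0, y 1) * u (x 1, y 0)"
  unfolding kernel_det_def
  by (subst laplace_expansion_row[where n = "Suc (Suc 0)" and i = 0])
     (auto simp: cofactor_def mat_delete_def det_single numeral_2_eq_2)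

text \<open>By \<open>kernel_det_bordered\<close> every determinant here is
  \<open>kernel_det u m x y\<close> times a minor of the Schur complement, of size 0, 1 or 2. What
  remains is the formula for a 2 by 2 determinant.\<close>

lemma kernel_det_Sylvester:
  assumes nz: "kernel_det u m x y \<noteq> 0"
  shows "kernel_det u (Suc (Suc m)) (x(m := a, Suc m := b)) (y(m := c, Suc m := d)) * kernel_det u m x y =
    kernel_det u (Suc m) (x(m := a)) (y(m := c)) * kernel_det u (Suc m) (x(m := b)) (y(m := d)) -
    kernel_det u (Suc m) (x(m := a)) (y(m := d)) * kernel_det u (Suc m) (x(m := b)) (y(m := c))"
proof -
  obtain s where s: "\<And>k x' y'. (\<And>i. i < m \<Longrightarrow> x' i = x i) \<Longrightarrow> (\<And>i. i < m \<Longrightarrow> y' i = y i) \<Longrightarrow>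
    kernel_det u (m + k) x' y' = kernel_det u m x y * kernel_det s k (\<lambda>i. x' (m + i)) (\<lambda>i. y' (m + i))"
    using kernel_det_bordered[OF nz] by blast
  have "kernel_det u (Suc m) (x(m := p)) (y(m := q)) = kernel_det u m x y * s (p, q)" for p q
    using s[of "x(m := p)" "y(m := q)" "Suc 0"] by (simp add: kernel_det_1)
  moreover have "kernel_det u (Suc (Suc m)) (x(m := a, Suc m := b)) (y(m := c, Suc m := d)) =
      kernel_det u m x y * (s (a, c) * s (b, d) - s (a, d) * s (b, c))"
    using s[of "x(m := a, Suc m := b)" "y(m := c, Suc m := d)" "Suc (Suc 0)"] by (simp add: kernel_det_2)
  ultimately show ?thesis by (simp add: left_diff_distrib right_diff_distrib mult_ac)
qed

section \<open>Vandermonde products and permutation of the coordinates\<close>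

lemma Vandermonde_0 [simp]: "Vandermonde 0 x = 1"
  by (simp add: Vandermonde_def)

lemma Vandermonde_Suc:
  "Vandermonde (Suc n) x = Vandermonde n x * (\<Prod>i<n. x i - x n)"
proof -
  have *: "{(i, j). i < j \<and> j < Suc n} = {(i, j). i < j \<and> j < n} \<union> (\<lambda>i. (i, n)) ` {..<n}"
    by (auto simp: less_Suc_eq)
  have "finite {(i, j). i < j \<and> j < n}"
    by (rule finite_subset[of _ "{..<n} \<times> {..<n}"]) auto
  then show ?thesis
    unfolding Vandermonde_def *
    by (subst prod.union_disjoint) (auto simp: prod.reindex inj_on_def)
qed

lemma Vandermonde_cong:
  "(\<And>i. i < n \<Longrightarrow> x i = x' i) \<Longrightarrow> Vandermonde n x = Vandermonde n x'"
  unfolding Vandermonde_def by (intro prod.cong) auto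

lemma Vandermonde_nonzero: "inj_on x {..<n} \<Longrightarrow> Vandermonde n x \<noteq> 0"
  unfolding Vandermonde_def
  by (subst prod_zero_iff) (auto simp: inj_on_def intro: finite_subset[of _ "{..<n} \<times> {..<n}"])

lemma Vandermonde_upd: "Vandermonde (Suc m) (x(m := a)) = Vandermonde m x * (\<Prod>i<m. x i - a)"
proof -
  have "Vandermonde m (x(m := a)) = Vandermonde m x" by (rule Vandermonde_cong) auto
  then show ?thesis by (simp add: Vandermonde_Suc)
qed

lemma Vandermonde_upd2:
  "Vandermonde (Suc (Suc m)) (x(m := a, Suc m := b)) =
    Vandermonde m x * (\<Prod>i<m. x i - a) * (\<Prod>i<m. x i - b) * (a - b)"
  by (simp add: Vandermonde_upd)

lemma kernel_det_transpose: "kernel_det u n x y = kernel_det (\<lambda>(p, q). u (q, p)) n y x"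
proof -
  have "Matrix.mat n n (\<lambda>(i, j). u (x j, y i)) = transpose_mat (Matrix.mat n n (\<lambda>(i, j). u (x i, y j)))"
    by (intro eq_matI) auto
  then show ?thesis
    unfolding kernel_det_def using det_transpose[of "Matrix.mat n n (\<lambda>(i, j). u (x i, y j))" n] by simp
qed

text \<open>Since \<open>M n\<close> is positive, its symmetry in the coordinates only requires permutation invariance up
  to sign of numerator and denominator.\<close>

lemma abs_kernel_det_permute:
  assumes "p permutes {..<n}"
  shows "\<bar>kernel_det u n (x \<circ> p) y\<bar> = \<bar>kernel_det u n x y\<bar>"
proof -
  have "p i < n" if "i < n" for i
    using permutes_in_image[OF assms, of i] that by simp
  then have "Matrix.mat n n (\<lambda>(i, j). u ((x \<circ> p) i, y j)) =
      Matrix.mat n n (\<lambda>(i, j). Matrix.mat n n (\<lambda>(i, j). u (x i, y j)) $$ (p i, j))"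
    by (intro eq_matI) auto
  then show ?thesis
    unfolding kernel_det_def using assms
    by (simp add: det_permute_rows[where n = n] lessThan_atLeast0 abs_mult sign_def)
qed

text \<open>The product over \<open>i < j\<close> is not respected by permutations. Its square is a
  product over all ordered pairs of distinct indices, which can be reindexed.\<close>

lemma Vandermonde_square:
  "(Vandermonde n x)\<^sup>2 = (\<Prod>i<n. \<Prod>j\<in>{..<n} - {i}. \<bar>x i - x j\<bar>)"
proof (induction n)
  case (Suc n)
  have "(\<Prod>i<Suc n. \<Prod>j\<in>{..<Suc n} - {i}. \<bar>x i - x j\<bar>) =
      (\<Prod>i<n. \<Prod>j\<in>insert n ({..<n} - {i}). \<bar>x i - x j\<bar>) * (\<Prod>j<n. \<bar>x n - x j\<bar>)"
  proof -
    have "{..<Suc n} - {i} = insert n ({..<n} - {i})" if "i < n" for i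
      using that by auto
    moreover have "{..<Suc n} - {n} = {..<n}" by auto
    ultimately show ?thesis by simp
  qed
  also have "\<dots> = (Vandermonde n x)\<^sup>2 * (\<Prod>i<n. \<bar>x i - x n\<bar>) * (\<Prod>j<n. \<bar>x n - x j\<bar>)"
    by (simp add: prod.distrib Suc.IH)
  also have "\<dots> = (Vandermonde n x)\<^sup>2 * \<bar>\<Prod>i<n. x i - x n\<bar>\<^sup>2"
    by (simp add: abs_prod abs_minus_commute power2_eq_square)
  also have "\<dots> = (Vandermonde (Suc n) x)\<^sup>2"
    by (simp add: Vandermonde_Suc power_mult_distrib)
  finally show ?case ..
qed simp

lemma abs_Vandermonde_permute:
  assumes p: "p permutes {..<n}"
  shows "\<bar>Vandermonde n (x \<circ> p)\<bar> = \<bar>Vandermonde n x\<bar>"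
proof -
  have "(\<Prod>i<n. \<Prod>j\<in>{..<n} - {i}. \<bar>(x \<circ> p) i - (x \<circ> p) j\<bar>) = (\<Prod>i<n. \<Prod>j\<in>{..<n} - {p i}. \<bar>x (p i) - x j\<bar>)"
  proof (rule prod.cong)
    fix i assume "i \<in> {..<n}"
    have "p ` ({..<n} - {i}) = {..<n} - {p i}"
      using permutes_image[OF p] permutes_inj[OF p] by (simp add: image_set_diff)
    then show "(\<Prod>j\<in>{..<n} - {i}. \<bar>(x \<circ> p) i - (x \<circ> p) j\<bar>) = (\<Prod>j\<in>{..<n} - {p i}. \<bar>x (p i) - x j\<bar>)"
      using prod.reindex[OF permutes_inj_on[OF p], of "\<lambda>j. \<bar>x (p i) - x j\<bar>" "{..<n} - {i}"] by simp
  qed simp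
  also have "\<dots> = (\<Prod>i<n. \<Prod>j\<in>{..<n} - {i}. \<bar>x i - x j\<bar>)"
    using prod.permute[OF p, of "\<lambda>i. \<Prod>j\<in>{..<n} - {i}. \<bar>x i - x j\<bar>"] by (simp add: comp_def)
  finally have "(Vandermonde n (x \<circ> p))\<^sup>2 = (Vandermonde n x)\<^sup>2"
    by (simp add: Vandermonde_square)
  then show ?thesis by (simp add: power2_eq_iff abs_eq_iff)
qed

section \<open>Perturbation to distinct coordinates\<close>

text \<open>A line through \<open>x\<close> whose coordinates have pairwise different slopes, so
  that a limit in the single real variable \<open>e\<close> reaches arbitrary points.\<close>

definition perturbation :: "nat \<Rightarrow> (nat \<Rightarrow> real) \<Rightarrow> real \<Rightarrow> nat \<Rightarrow> real" where
  "perturbation n x e = (\<lambda>i. if i < n then x i + e * real i else 0)"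

lemma perturbation_0: "x \<in> topspace (Euclidean_space n) \<Longrightarrow> perturbation n x 0 = x"
  by (auto simp: perturbation_def topspace_Euclidean_space)

lemma perturbation_in_topspace [simp]: "perturbation n x e \<in> topspace (Euclidean_space n)"
  by (auto simp: perturbation_def topspace_Euclidean_space)

lemma continuous_on_perturbation: "continuous_on UNIV (\<lambda>e. perturbation n x e i)"
  by (cases "i < n") (auto simp: perturbation_def intro!: continuous_intros)

lemma eventually_inj_on_perturbation: "eventually (\<lambda>e. inj_on (perturbation n x e) {..<n}) (at 0)"
proof -
  have "eventually (\<lambda>e. perturbation n x e i = perturbation n x e j \<longrightarrow> i = j) (at 0)"
    if "i < n" "j < n" for i j
  proof (cases "i = j")
    case False
    \<comment> \<open>The excluded value is the only \<open>e\<close> at which coordinates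
      \<open>i\<close> and \<open>j\<close> agree.\<close>
    have "eventually (\<lambda>e. e \<noteq> (x i - x j) / (real j - real i)) (at 0)"
      by (rule eventually_neq_at_within)
    then show ?thesis
      by eventually_elim (use False that in \<open>auto simp: perturbation_def field_simps\<close>)
  qed simp
  then have "eventually (\<lambda>e. \<forall>i\<in>{..<n}. \<forall>j\<in>{..<n}. perturbation n x e i = perturbation n x e j \<longrightarrow> i = j) (at 0)"
    by (intro eventually_ball_finite finite_lessThan ballI) (simp only: lessThan_iff)
  then show ?thesis by (simp add: inj_on_def)
qed

text \<open>Carries identities from distinct coordinates, that is from small nonzero
  \<open>e\<close>, to \<open>e = 0\<close>.\<close>

lemma continuous_eventually_eq_at_imp_eq:
  fixes f g :: "real \<Rightarrow> real"
  assumes "continuous_on UNIV f" "continuous_on UNIV g" "eventually (\<lambda>e. f e = g e) (at a)"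
  shows "f a = g a"
proof -
  have "(f \<longlongrightarrow> f a) (at a)" "(g \<longlongrightarrow> g a) (at a)"
    using assms(1,2) by (auto simp: continuous_on_def)
  moreover from this(1) have "(g \<longlongrightarrow> f a) (at a)"
    by (rule Lim_transform_eventually) (rule assms(3))
  ultimately show ?thesis
    using tendsto_unique[of "at a" g] by simp
qed

lemma permute_in_Euclidean_space:
  assumes "p permutes {..<n}" "x \<in> topspace (Euclidean_space n)"
  shows "x \<circ> p \<in> topspace (Euclidean_space n)"
  using assms permutes_not_in[OF assms(1)] by (auto simp: topspace_Euclidean_space)

section \<open>Changing one coordinate at a time\<close>

definition step_vector :: "nat \<Rightarrow> nat \<Rightarrow> real \<Rightarrow> real \<Rightarrow> nat \<Rightarrow> real" where
  "step_vector n k a b = (\<lambda>i. if i < k then b else if i < n then a else 0)"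

lemma step_vector_in_topspace: "k \<le> n \<Longrightarrow> step_vector n k a b \<in> topspace (Euclidean_space n)"
  by (auto simp: step_vector_def topspace_Euclidean_space)

lemma step_vector_0: "step_vector n 0 a b = scaled_ones n a"
  by (auto simp: step_vector_def scaled_ones_def)

lemma step_vector_full: "step_vector n n a b = scaled_ones n b"
  by (auto simp: step_vector_def scaled_ones_def)

lemma step_vector_const: "k \<le> n \<Longrightarrow> step_vector n k a a = scaled_ones n a"
  by (auto simp: step_vector_def scaled_ones_def)

lemma step_vector_upd_left: "k \<le> m \<Longrightarrow> (step_vector m k a b)(m := a) = step_vector (Suc m) k a b"
  by (auto simp: step_vector_def)

text \<open>The appended \<open>b\<close> stands at place \<open>m\<close>, whereas the next step
  vector has it at place \<open>k\<close>. This is where the symmetry of \<open>M\<close> in its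
  coordinates enters.\<close>

lemma step_vector_upd_right:
  "k \<le> m \<Longrightarrow> (step_vector m k a b)(m := b) = step_vector (Suc m) (Suc k) a b \<circ> Transposition.transpose k m"
  by (auto simp: step_vector_def fun_eq_iff Transposition.transpose_def)

lemma continuous_on_step_vector:
  "continuous_on S a \<Longrightarrow> continuous_on S b \<Longrightarrow> continuous_on S (\<lambda>t. step_vector n k (a t) (b t) i)"
  unfolding step_vector_def by (cases "i < k"; cases "i < n") simp_all

lemma upd_in_Euclidean_space:
  "x \<in> topspace (Euclidean_space m) \<Longrightarrow> x(m := a) \<in> topspace (Euclidean_space (Suc m))"
  by (auto simp: topspace_Euclidean_space)

lemma continuous_on_fun_upd:
  fixes f :: "'a :: topological_space \<Rightarrow> 'b \<Rightarrow> 'c :: topological_space"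
  assumes "\<And>i. continuous_on S (\<lambda>t. f t i)" "continuous_on S g"
  shows "continuous_on S (\<lambda>t. ((f t)(j := g t)) i)"
  using assms by (cases "i = j") auto

lemma inj_on_upd2_D:
  fixes z :: "nat \<Rightarrow> 'a"
  assumes "inj_on (z(m := s, Suc m := t)) {..<Suc (Suc m)}"
  shows "inj_on z {..<m}" "inj_on (z(m := s)) {..<Suc m}" "inj_on (z(m := t)) {..<Suc m}"
proof -
  let ?z = "z(m := s, Suc m := t)"
  have z: "inj_on (z(m := v)) {..<Suc m}" if "inj_on z {..<m}" "v \<notin> z ` {..<m}" for v
    using that by (auto simp: lessThan_Suc inj_on_def)
  have "inj_on ?z {..<m}"
    by (rule inj_on_subset[OF assms]) auto
  then show inj: "inj_on z {..<m}"
    by (rule inj_on_cong[THEN iffD1, rotated]) simp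
  have "s \<noteq> z i" "t \<noteq> z i" if "i < m" for i
    using inj_onD[OF assms, of m i] inj_onD[OF assms, of "Suc m" i] that by auto
  then show "inj_on (z(m := s)) {..<Suc m}" "inj_on (z(m := t)) {..<Suc m}"
    by (auto intro!: z inj)
qed

text \<open>Telescoping in \<open>l\<close>, then in \<open>k\<close>.\<close>

lemma sum_mixed_differences:
  fixes P :: "nat \<Rightarrow> nat \<Rightarrow> real"
  shows "(\<Sum>k<m. \<Sum>l<n. P k l + P (Suc k) (Suc l) - P k (Suc l) - P (Suc k) l) =
    P 0 0 + P m n - P 0 n - P m 0"
proof -
  have "(\<Sum>l<n. P k l + P (Suc k) (Suc l) - P k (Suc l) - P (Suc k) l) =
      (\<Sum>l<n. (P (Suc k) (Suc l) - P k (Suc l)) - (P (Suc k) l - P k l))" for k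
    by (intro sum.cong) auto
  also have "\<dots> k = (P (Suc k) n - P (Suc k) 0) - (P k n - P k 0)" for k
    by (subst sum_lessThan_telescope) simp
  finally show ?thesis
    by (simp only: sum_lessThan_telescope[of "\<lambda>k. P k n - P k 0"])
qed

text \<open>Caratheodory's criterion: \<open>r\<close> itself is the slope function of
  \<open>1 + (x - a) * r x\<close> at \<open>a\<close>, so continuity of \<open>r\<close> at
  \<open>a\<close> suffices.\<close>

lemma DERIV_ln_one_plus_mult:
  fixes r :: "real \<Rightarrow> real"
  assumes "isCont r a"
  shows "((\<lambda>x. ln (1 + (x - a) * r x)) has_real_derivative r a) (at a)"
proof -
  have "((\<lambda>x. 1 + (x - a) * r x) has_real_derivative r a) (at a)"
    unfolding CARAT_DERIV using assms by (intro exI[of _ r]) auto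
  from DERIV_chain2[OF _ this, of ln 1] show ?thesis
    using DERIV_ln[of "1 :: real"] by simp
qed

section \<open>The constants c_n\<close>

lemma superfactorial_const_Suc:
  "superfactorial_const (Suc m) = superfactorial_const m / fact m"
  \<comment> \<open>For \<open>m = 0\<close> truncated subtraction makes both products
    empty.\<close>
  by (cases m) (simp_all add: superfactorial_const_def field_simps)

lemma superfactorial_const_pos: "superfactorial_const m > 0"
  by (auto simp: superfactorial_const_def intro!: prod_pos)

text \<open>The left-hand side is the square of c_{m+1}^2 / (c_m c_{m+2}) = (m+1)! / m! = m + 1. It
  matches the number of pairs (k, l) counted in \<open>DERIV_lnM_slope\<close>.\<close>

lemma superfactorial_const_ratio:
  "superfactorial_const m powi (-2) * superfactorial_const (Suc (Suc m)) powi (-2) /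
    (superfactorial_const (Suc m) powi (-2))\<^sup>2 = (real (Suc m))\<^sup>2"
  using superfactorial_const_pos[of m]
  by (simp add: superfactorial_const_Suc power_int_minus field_simps power2_eq_square)

section \<open>Positive extensions\<close>

text \<open>The case \<open>n = 0\<close> is included so that Sylvester's identity can start from
  the empty matrix.\<close>

locale positive_extensions =
  fixes u :: "real \<times> real \<Rightarrow> real" and M :: "nat \<Rightarrow> (nat \<Rightarrow> real) \<times> (nat \<Rightarrow> real) \<Rightarrow> real"
  assumes positive_extension: "is_positive_extension u n (M n)"
begin

lemma M_pos:
  "x \<in> topspace (Euclidean_space n) \<Longrightarrow> y \<in> topspace (Euclidean_space n) \<Longrightarrow> M n (x, y) > 0"
  using positive_extension by (auto simp: is_positive_extension_def)

lemma kernel_det_eq_M: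
  assumes "x \<in> topspace (Euclidean_space n)" "y \<in> topspace (Euclidean_space n)"
    and inj: "inj_on x {..<n}" "inj_on y {..<n}"
  shows "kernel_det u n x y = M n (x, y) * Vandermonde n x * Vandermonde n y"
  using positive_extension[of n] Vandermonde_nonzero[OF inj(1)] Vandermonde_nonzero[OF inj(2)] assms
  by (auto simp: is_positive_extension_def)

text \<open>Reduces continuity in the product topology to continuity of the single
  coordinates.\<close>

lemma continuous_on_M:
  fixes f g :: "'a :: topological_space \<Rightarrow> nat \<Rightarrow> real"
  assumes "\<And>t. f t \<in> topspace (Euclidean_space n)" "\<And>t. g t \<in> topspace (Euclidean_space n)"
    and "\<And>i. continuous_on UNIV (\<lambda>t. f t i)" "\<And>i. continuous_on UNIV (\<lambda>t. g t i)"
  shows "continuous_on UNIV (\<lambda>t. M n (f t, g t))"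
proof -
  have "continuous_map euclidean (Euclidean_space n) h"
    if "\<And>t. h t \<in> topspace (Euclidean_space n)" "\<And>i. continuous_on UNIV (\<lambda>t. h t i)"
    for h :: "'a \<Rightarrow> nat \<Rightarrow> real"
    using that
    by (auto simp: Euclidean_space_def continuous_map_in_subtopology continuous_map_componentwise_UNIV)
  then have "continuous_map euclidean (prod_topology (Euclidean_space n) (Euclidean_space n)) (\<lambda>t. (f t, g t))"
    using assms by (intro continuous_map_pairedI) auto
  from continuous_map_compose[OF this, of euclideanreal "M n"] positive_extension[of n]
  show ?thesis by (simp add: is_positive_extension_def comp_def)
qed

lemma continuous_on_M_upd:
  fixes f g :: "'a :: topological_space \<Rightarrow> nat \<Rightarrow> real"
  assumes "\<And>t. f t \<in> topspace (Euclidean_space n)" "\<And>t. g t \<in> topspace (Euclidean_space n)"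
    and "\<And>i. continuous_on UNIV (\<lambda>t. f t i)" "\<And>i. continuous_on UNIV (\<lambda>t. g t i)"
    and "continuous_on UNIV a" "continuous_on UNIV b"
  shows "continuous_on UNIV (\<lambda>t. M (Suc n) ((f t)(n := a t), (g t)(n := b t)))"
  by (rule continuous_on_M) (simp_all add: assms upd_in_Euclidean_space continuous_on_fun_upd del: fun_upd_apply)

lemma continuous_on_M_upd2:
  fixes f g :: "'a :: topological_space \<Rightarrow> nat \<Rightarrow> real"
  assumes "\<And>t. f t \<in> topspace (Euclidean_space n)" "\<And>t. g t \<in> topspace (Euclidean_space n)"
    and "\<And>i. continuous_on UNIV (\<lambda>t. f t i)" "\<And>i. continuous_on UNIV (\<lambda>t. g t i)"
    and "continuous_on UNIV a" "continuous_on UNIV b" "continuous_on UNIV a'" "continuous_on UNIV b'"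
  shows "continuous_on UNIV (\<lambda>t. M (Suc (Suc n))
    ((f t)(n := a t, Suc n := a' t), (g t)(n := b t, Suc n := b' t)))"
  by (rule continuous_on_M_upd) (simp_all add: assms upd_in_Euclidean_space continuous_on_fun_upd del: fun_upd_apply)

text \<open>For distinct coordinates the absolute values of the determinant and of the Vandermonde
  products are invariant, and positivity of \<open>M\<close> fixes the sign. Perturbation gives the
  rest.\<close>

lemma M_permute:
  assumes p: "p permutes {..<n}" and q: "q permutes {..<n}"
    and x: "x \<in> topspace (Euclidean_space n)" and y: "y \<in> topspace (Euclidean_space n)"
  shows "M n (x \<circ> p, y \<circ> q) = M n (x, y)"
proof -
  have distinct: "M n (x \<circ> p, y \<circ> q) = M n (x, y)"
    if x: "x \<in> topspace (Euclidean_space n)" "inj_on x {..<n}"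
      and y: "y \<in> topspace (Euclidean_space n)" "inj_on y {..<n}" for x y
  proof -
    have "inj_on (x \<circ> p) {..<n}" "inj_on (y \<circ> q) {..<n}"
      using x y p q by (auto intro!: comp_inj_on permutes_inj_on simp: permutes_image)
    then have "kernel_det u n (x \<circ> p) (y \<circ> q) =
        M n (x \<circ> p, y \<circ> q) * Vandermonde n (x \<circ> p) * Vandermonde n (y \<circ> q)"
      using x y by (intro kernel_det_eq_M permute_in_Euclidean_space p q)
    moreover have "\<bar>kernel_det u n (x \<circ> p) (y \<circ> q)\<bar> = \<bar>kernel_det u n x y\<bar>"
      \<comment> \<open>Transposing turns the permutation of columns into one of rows.\<close>
      using p q by (metis abs_kernel_det_permute kernel_det_transpose)
    moreover have "M n (x \<circ> p, y \<circ> q) > 0" "M n (x, y) > 0"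
      using x y by (auto intro!: M_pos permute_in_Euclidean_space p q)
    ultimately show ?thesis
      using kernel_det_eq_M[OF x(1) y(1) x(2) y(2)] Vandermonde_nonzero[OF x(2)] Vandermonde_nonzero[OF y(2)]
      by (simp add: abs_mult abs_Vandermonde_permute[OF p] abs_Vandermonde_permute[OF q])
  qed
  \<comment> \<open>The points are perturbed before they are permuted, so \<open>distinct\<close>
    applies to them as it stands.\<close>
  have "M n (perturbation n x 0 \<circ> p, perturbation n y 0 \<circ> q) = M n (perturbation n x 0, perturbation n y 0)"
  proof (rule continuous_eventually_eq_at_imp_eq[where a = 0
        and f = "\<lambda>e. M n (perturbation n x e \<circ> p, perturbation n y e \<circ> q)"
        and g = "\<lambda>e. M n (perturbation n x e, perturbation n y e)"])
    show "eventually (\<lambda>e. M n (perturbation n x e \<circ> p, perturbation n y e \<circ> q) =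
        M n (perturbation n x e, perturbation n y e)) (at 0)"
      using eventually_inj_on_perturbation[of n x] eventually_inj_on_perturbation[of n y]
      by eventually_elim (simp add: distinct)
  qed (rule continuous_on_M; simp add: permute_in_Euclidean_space p q continuous_on_perturbation)+
  then show ?thesis by (simp add: perturbation_0 x y)
qed

text \<open>All three products in Sylvester's identity share the Vandermonde factor
  \<open>V * V * A a * A b * B c * B d\<close>, and the left one has the further factor
  \<open>(a - b) * (c - d)\<close>. The common factor is nonzero and cancels.\<close>

lemma M_Sylvester_distinct:
  assumes x: "x \<in> topspace (Euclidean_space m)" "inj_on (x(m := a, Suc m := b)) {..<Suc (Suc m)}"
    and y: "y \<in> topspace (Euclidean_space m)" "inj_on (y(m := c, Suc m := d)) {..<Suc (Suc m)}"
  shows "M (Suc (Suc m)) (x(m := a, Suc m := b), y(m := c, Suc m := d)) * M m (x, y) * ((a - b) * (c - d)) =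
    M (Suc m) (x(m := a), y(m := c)) * M (Suc m) (x(m := b), y(m := d)) -
    M (Suc m) (x(m := a), y(m := d)) * M (Suc m) (x(m := b), y(m := c))"
proof -
  note inj = inj_on_upd2_D
  define A where "A = (\<lambda>s. \<Prod>i<m. x i - s)"
  define B where "B = (\<lambda>s. \<Prod>i<m. y i - s)"
  define D where "D = (a - b) * (c - d)"
  define V where "V = Vandermonde m x * Vandermonde m y"
  note up = upd_in_Euclidean_space
  have K0: "kernel_det u m x y = M m (x, y) * V"
    using kernel_det_eq_M[OF x(1) y(1) inj(1)[OF x(2)] inj(1)[OF y(2)]] by (simp add: V_def)
  have K1: "kernel_det u (Suc m) (x(m := s)) (y(m := t)) = M (Suc m) (x(m := s), y(m := t)) * V * A s * B t"
    if "s \<in> {a, b}" "t \<in> {c, d}" for s t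
    using that inj[OF x(2)] inj[OF y(2)]
    by (subst kernel_det_eq_M[OF up[OF x(1)] up[OF y(1)]])
       (auto simp only: Vandermonde_upd A_def B_def V_def mult_ac insert_iff empty_iff)
  have K2: "kernel_det u (Suc (Suc m)) (x(m := a, Suc m := b)) (y(m := c, Suc m := d)) =
      M (Suc (Suc m)) (x(m := a, Suc m := b), y(m := c, Suc m := d)) * V * A a * A b * B c * B d * D"
    unfolding kernel_det_eq_M[OF up[OF up[OF x(1)]] up[OF up[OF y(1)]] x(2) y(2)]
      Vandermonde_upd2 A_def B_def V_def D_def by (simp only: mult_ac)
  have V: "V \<noteq> 0"
    using Vandermonde_nonzero[OF inj(1)[OF x(2)]] Vandermonde_nonzero[OF inj(1)[OF y(2)]] by (simp add: V_def)
  have AB: "A a \<noteq> 0" "A b \<noteq> 0" "B c \<noteq> 0" "B d \<noteq> 0"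
    using Vandermonde_nonzero[OF inj(2)[OF x(2)]] Vandermonde_nonzero[OF inj(3)[OF x(2)]]
      Vandermonde_nonzero[OF inj(2)[OF y(2)]] Vandermonde_nonzero[OF inj(3)[OF y(2)]]
    unfolding Vandermonde_upd A_def B_def by auto
  have "kernel_det u m x y \<noteq> 0"
    using M_pos[OF x(1) y(1)] V by (simp add: K0)
  from kernel_det_Sylvester[OF this, of a b c d]
  have "(V * V * A a * A b * B c * B d) *
      (M (Suc (Suc m)) (x(m := a, Suc m := b), y(m := c, Suc m := d)) * M m (x, y) * D) =
    (V * V * A a * A b * B c * B d) *
      (M (Suc m) (x(m := a), y(m := c)) * M (Suc m) (x(m := b), y(m := d)) -
       M (Suc m) (x(m := a), y(m := d)) * M (Suc m) (x(m := b), y(m := c)))"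
    unfolding K0 K2 K1[of a c, simplified] K1[of a d, simplified] K1[of b c, simplified] K1[of b d, simplified]
    by (simp only: right_diff_distrib mult_ac)
  then show ?thesis using V AB by (simp add: D_def)
qed

lemma M_Sylvester:
  assumes x: "x \<in> topspace (Euclidean_space m)" and y: "y \<in> topspace (Euclidean_space m)"
  shows "M (Suc (Suc m)) (x(m := a, Suc m := b), y(m := c, Suc m := d)) * M m (x, y) * ((a - b) * (c - d)) =
    M (Suc m) (x(m := a), y(m := c)) * M (Suc m) (x(m := b), y(m := d)) -
    M (Suc m) (x(m := a), y(m := d)) * M (Suc m) (x(m := b), y(m := c))"
proof -
  define X where "X = perturbation m x"
  define Y where "Y = perturbation m y"
  \<comment> \<open>All \<open>m + 2\<close> coordinates are perturbed together: \<open>a\<close>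
    and \<open>c\<close> move as coordinate \<open>m\<close>, \<open>b\<close> and \<open>d\<close>
    as coordinate \<open>m + 1\<close>. They keep these shifts in the vectors of length
    \<open>m + 1\<close>, even where \<open>b\<close> or \<open>d\<close> sits at place
    \<open>m\<close>.\<close>
  define s where "s = (\<lambda>v e. v + e * real m)"
  define t where "t = (\<lambda>v e. v + e * real (Suc m))"
  have perturbation_upd: "perturbation (Suc (Suc m)) (z(m := v, Suc m := w)) e =
      (perturbation m z e)(m := s v e, Suc m := t w e)" for z v w e
    by (auto simp: perturbation_def s_def t_def)
  let ?L = "\<lambda>e. M (Suc (Suc m)) ((X e)(m := s a e, Suc m := t b e), (Y e)(m := s c e, Suc m := t d e)) *
    M m (X e, Y e) * ((s a e - t b e) * (s c e - t d e))"
  let ?R = "\<lambda>e. M (Suc m) ((X e)(m := s a e), (Y e)(m := s c e)) * M (Suc m) ((X e)(m := t b e), (Y e)(m := t d e)) -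
    M (Suc m) ((X e)(m := s a e), (Y e)(m := t d e)) * M (Suc m) ((X e)(m := t b e), (Y e)(m := s c e))"
  have XY: "X e \<in> topspace (Euclidean_space m)" "Y e \<in> topspace (Euclidean_space m)" for e
    by (simp_all add: X_def Y_def)
  have cont: "continuous_on UNIV (\<lambda>e. X e i)" "continuous_on UNIV (\<lambda>e. Y e i)" for i
    by (auto simp: X_def Y_def continuous_on_perturbation)
  have st: "continuous_on UNIV (s v)" "continuous_on UNIV (t v)" for v
    by (auto simp: s_def t_def intro!: continuous_intros)
  have "?L 0 = ?R 0"
  proof (rule continuous_eventually_eq_at_imp_eq[where a = 0 and f = ?L and g = ?R])
    show "eventually (\<lambda>e. ?L e = ?R e) (at 0)"
      using eventually_inj_on_perturbation[of "Suc (Suc m)" "x(m := a, Suc m := b)"]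
        eventually_inj_on_perturbation[of "Suc (Suc m)" "y(m := c, Suc m := d)"]
      by eventually_elim
         (intro M_Sylvester_distinct, simp_all only: perturbation_upd X_def Y_def perturbation_in_topspace)
  qed (rule continuous_on_mult continuous_on_diff continuous_on_M_upd2 continuous_on_M_upd continuous_on_M cont st XY)+
  then show ?thesis
    by (simp add: X_def Y_def s_def t_def perturbation_0 x y)
qed

text \<open>Chosen so that, by Sylvester's identity, \<open>M (Suc m)\<close> at (xa; yc) times its
  value at (xb; yd), divided by its values at (xa; yd) and (xb; yc), equals
  \<open>1 + (b - a) * (d - c) * rho\<close>.\<close>

definition rho :: "nat \<Rightarrow> nat \<Rightarrow> nat \<Rightarrow> real \<Rightarrow> real \<Rightarrow> real \<Rightarrow> real \<Rightarrow> real" where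
  "rho m k l a b c d =
    (let x = step_vector m k a b; y = step_vector m l c d in
     M (Suc (Suc m)) (x(m := a, Suc m := b), y(m := c, Suc m := d)) * M m (x, y) /
     (M (Suc m) (x(m := a), y(m := d)) * M (Suc m) (x(m := b), y(m := c))))"

text \<open>Stated along curves because it is applied with \<open>b\<close> or \<open>d\<close>
  moving alone and with \<open>a = b\<close> or \<open>c = d\<close> moving together.\<close>

lemma continuous_on_rho:
  fixes a b c d :: "real \<Rightarrow> real"
  assumes "k \<le> m" "l \<le> m"
    and "continuous_on UNIV a" "continuous_on UNIV b" "continuous_on UNIV c" "continuous_on UNIV d"
  shows "continuous_on UNIV (\<lambda>t. rho m k l (a t) (b t) (c t) (d t))"
proof -
  have denominator: "M (Suc m) (x(m := s), y(m := t)) * M (Suc m) (x(m := s'), y(m := t')) \<noteq> 0"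
    if "x \<in> topspace (Euclidean_space m)" "y \<in> topspace (Euclidean_space m)" for x y s s' t t'
    using that by (simp add: M_pos upd_in_Euclidean_space less_imp_neq[THEN not_sym])
  note step_vector = step_vector_in_topspace[OF assms(1)] step_vector_in_topspace[OF assms(2)]
    continuous_on_step_vector[OF assms(3,4)] continuous_on_step_vector[OF assms(5,6)]
  show ?thesis
    unfolding rho_def Let_def
    by (rule continuous_on_divide continuous_on_mult continuous_on_M_upd2 continuous_on_M_upd continuous_on_M
        step_vector assms(3-6) ballI denominator)+
qed

section \<open>The mixed difference of ln M as a double sum\<close>

definition lnM :: "nat \<Rightarrow> real \<Rightarrow> real \<Rightarrow> real" where
  "lnM n a c = ln (M n (scaled_ones n a, scaled_ones n c))"

text \<open>With equal endpoints all step vectors are constant, so \<open>k\<close> and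
  \<open>l\<close> drop out. What remains is the Toda quotient up to the constants c_n.\<close>

lemma rho_const:
  assumes "k \<le> m" "l \<le> m"
  shows "rho m k l a a c c = M (Suc (Suc m)) (scaled_ones (Suc (Suc m)) a, scaled_ones (Suc (Suc m)) c) *
    M m (scaled_ones m a, scaled_ones m c) / (M (Suc m) (scaled_ones (Suc m) a, scaled_ones (Suc m) c))\<^sup>2"
proof -
  have "(scaled_ones n t)(n := t) = scaled_ones (Suc n) t" for n t
    by (auto simp: scaled_ones_def)
  then show ?thesis
    using assms by (simp add: rho_def Let_def step_vector_const power2_eq_square)
qed

text \<open>\<open>P k l\<close> records the value after \<open>k\<close> and \<open>l\<close>
  coordinates have moved. Sylvester's identity evaluates the mixed difference over one cell of this
  grid, and the cells telescope to the four corners.\<close>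

lemma mixed_difference_lnM:
  "lnM (Suc m) a c + lnM (Suc m) b d - lnM (Suc m) a d - lnM (Suc m) b c =
    (\<Sum>k<Suc m. \<Sum>l<Suc m. ln (1 + (b - a) * ((d - c) * rho m k l a b c d)))"
proof -
  define P where "P = (\<lambda>k l. ln (M (Suc m) (step_vector (Suc m) k a b, step_vector (Suc m) l c d)))"
  have "P k l + P (Suc k) (Suc l) - P k (Suc l) - P (Suc k) l = ln (1 + (b - a) * ((d - c) * rho m k l a b c d))"
    if "k \<le> m" "l \<le> m" for k l
  proof -
    define x where "x = step_vector m k a b"
    define y where "y = step_vector m l c d"
    have xy: "x \<in> topspace (Euclidean_space m)" "y \<in> topspace (Euclidean_space m)"
      using that by (auto simp: x_def y_def step_vector_in_topspace)
    have t: "Transposition.transpose k m permutes {..<Suc m}" "Transposition.transpose l m permutes {..<Suc m}"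
      using that by (auto intro!: permutes_swap_id)
    have top: "step_vector (Suc m) j p q \<in> topspace (Euclidean_space (Suc m))" if "j \<le> Suc m" for j p q
      by (rule step_vector_in_topspace[OF that])
    have x': "x(m := a) = step_vector (Suc m) k a b" "y(m := c) = step_vector (Suc m) l c d"
      "x(m := b) = step_vector (Suc m) (Suc k) a b \<circ> Transposition.transpose k m"
      "y(m := d) = step_vector (Suc m) (Suc l) c d \<circ> Transposition.transpose l m"
      using that by (auto simp: x_def y_def step_vector_upd_left step_vector_upd_right)
    define M1 where "M1 = (\<lambda>s t. M (Suc m) (x(m := s), y(m := t)))"
    have pos: "M1 s t > 0" for s t
      unfolding M1_def by (intro M_pos upd_in_Euclidean_space xy)
    \<comment> \<open>The arguments agree up to the transpositions in \<open>x'\<close>, which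
      \<open>M_permute\<close> removes.\<close>
    have P: "P k l = ln (M1 a c)" "P (Suc k) l = ln (M1 b c)"
      "P k (Suc l) = ln (M1 a d)" "P (Suc k) (Suc l) = ln (M1 b d)"
      using M_permute[OF t top top, of "Suc k" "Suc l"] M_permute[OF t(1) permutes_id top top, of "Suc k" l]
        M_permute[OF permutes_id t(2) top top, of k "Suc l"] that
      by (simp_all add: P_def M1_def x')
    have nz: "M1 s t \<noteq> 0" for s t
      using pos[of s t] by simp
    define N where "N = M (Suc (Suc m)) (x(m := a, Suc m := b), y(m := c, Suc m := d)) * M m (x, y)"
    have "M1 a c * M1 b d = M1 a d * M1 b c + (b - a) * ((d - c) * N)"
      using M_Sylvester[OF xy, of a b c d] by (simp add: M1_def N_def algebra_simps)
    moreover have "rho m k l a b c d = N / (M1 a d * M1 b c)"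
      by (simp add: rho_def Let_def x_def y_def M1_def N_def)
    ultimately have "(M1 a c * M1 b d) / (M1 a d * M1 b c) = 1 + (b - a) * ((d - c) * rho m k l a b c d)"
      by (simp add: add_divide_distrib nz)
    moreover have "ln ((M1 a c * M1 b d) / (M1 a d * M1 b c)) = P k l + P (Suc k) (Suc l) - P k (Suc l) - P (Suc k) l"
      by (simp add: P ln_div ln_mult pos nz)
    ultimately show ?thesis by simp
  qed
  then have "(\<Sum>k<Suc m. \<Sum>l<Suc m. ln (1 + (b - a) * ((d - c) * rho m k l a b c d))) =
      (\<Sum>k<Suc m. \<Sum>l<Suc m. P k l + P (Suc k) (Suc l) - P k (Suc l) - P (Suc k) l)"
    by (intro sum.cong refl) auto
  then show ?thesis
    unfolding sum_mixed_differences by (simp add: P_def lnM_def step_vector_0 step_vector_full)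
qed

section \<open>Differentiating and integrating the double sum\<close>

definition lnM_slope :: "nat \<Rightarrow> real \<Rightarrow> real \<Rightarrow> real \<Rightarrow> real" where
  "lnM_slope m x c d = (\<Sum>k<Suc m. \<Sum>l<Suc m. (d - c) * rho m k l x x c d)"

text \<open>With the corner \<open>x\<close> fixed, the difference at \<open>b\<close> is a constant
  plus terms ln (1 + (b - x) r(b)) with \<open>r\<close> continuous at \<open>x\<close>. Their
  derivatives at \<open>b = x\<close> add up to \<open>lnM_slope\<close>.\<close>

lemma DERIV_lnM_difference:
  "((\<lambda>x. lnM (Suc m) x d - lnM (Suc m) x c) has_real_derivative lnM_slope m x c d) (at x)"
proof -
  have lnM: "(\<lambda>b. lnM (Suc m) b d - lnM (Suc m) b c) = (\<lambda>b. (lnM (Suc m) x d - lnM (Suc m) x c) +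
    (\<Sum>k<Suc m. \<Sum>l<Suc m. ln (1 + (b - x) * ((d - c) * rho m k l x b c d))))"
  proof
    show "lnM (Suc m) b d - lnM (Suc m) b c = (lnM (Suc m) x d - lnM (Suc m) x c) +
      (\<Sum>k<Suc m. \<Sum>l<Suc m. ln (1 + (b - x) * ((d - c) * rho m k l x b c d)))" for b
      using mixed_difference_lnM[of m x c b d] by linarith
  qed
  have "isCont (\<lambda>b. (d - c) * rho m k l x b c d) x" if "k < Suc m" "l < Suc m" for k l
    using continuous_on_rho[of k m l "\<lambda>_. x" "\<lambda>b. b" "\<lambda>_. c" "\<lambda>_. d"] that
    by (auto simp: continuous_on_eq_continuous_at intro!: continuous_intros)
  then have D: "((\<lambda>b. ln (1 + (b - x) * ((d - c) * rho m k l x b c d)))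
      has_real_derivative (d - c) * rho m k l x x c d) (at x)"
    if "k < Suc m" "l < Suc m" for k l
    using that by (intro DERIV_ln_one_plus_mult[where r = "\<lambda>b. (d - c) * rho m k l x b c d"])
  have "((\<lambda>b. (lnM (Suc m) x d - lnM (Suc m) x c) + (\<Sum>k<Suc m. \<Sum>l<Suc m.
      ln (1 + (b - x) * ((d - c) * rho m k l x b c d)))) has_real_derivative 0 + lnM_slope m x c d) (at x)"
    unfolding lnM_slope_def by (intro DERIV_add DERIV_const DERIV_sum D) (simp_all only: lessThan_iff)
  then show ?thesis
    unfolding lnM by (simp only: add_0)
qed

text \<open>By additivity, the derivative of \<open>lnM_slope m x c\<close> at \<open>d\<close> is read off from the slope over
  \<open>[d, e]\<close> as \<open>e\<close> tends to \<open>d\<close>.\<close>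

lemma lnM_slope_additive: "lnM_slope m x c d + lnM_slope m x d e = lnM_slope m x c e"
\<comment> \<open>Additivity is hidden in the defining sum, where the step vectors change with the
  endpoints. It is visible in the function being differentiated.\<close>
proof (rule DERIV_unique)
  show "((\<lambda>x. lnM (Suc m) x e - lnM (Suc m) x c)
      has_real_derivative lnM_slope m x c d + lnM_slope m x d e) (at x)"
    using DERIV_add[OF DERIV_lnM_difference[of m d c x] DERIV_lnM_difference[of m e d x]] by simp
qed (rule DERIV_lnM_difference)

text \<open>By additivity the sum of the \<open>rho m k l x x d e\<close> is the slope function at
  \<open>d\<close> in Caratheodory's sense. At \<open>e = d\<close> its (m+1)^2 terms coincide by
  \<open>rho_const\<close>.\<close>

lemma DERIV_lnM_slope:
  "((\<lambda>d. lnM_slope m x c d) has_real_derivative (real (Suc m))\<^sup>2 * rho m 0 0 x x d d) (at d)"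
proof -
  have "lnM_slope m x c e - lnM_slope m x c d = (\<Sum>k<Suc m. \<Sum>l<Suc m. rho m k l x x d e) * (e - d)" for e
  proof -
    have "lnM_slope m x d e = (\<Sum>k<Suc m. \<Sum>l<Suc m. rho m k l x x d e) * (e - d)"
      unfolding lnM_slope_def sum_distrib_left[symmetric] by (rule mult.commute)
    then show ?thesis using lnM_slope_additive[of m x c d e] by linarith
  qed
  moreover have "continuous_on UNIV (\<lambda>e. \<Sum>k<Suc m. \<Sum>l<Suc m. rho m k l x x d e)"
    by (intro continuous_on_sum continuous_on_rho continuous_intros) auto
  moreover have "(\<Sum>k<Suc m. \<Sum>l<Suc m. rho m k l x x d d) = (\<Sum>k<Suc m. \<Sum>l<Suc m. rho m 0 0 x x d d)"
    by (intro sum.cong refl) (simp add: rho_const)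
  ultimately show ?thesis
    by (auto simp: CARAT_DERIV continuous_on_eq_continuous_at power2_eq_square
      intro!: exI[of _ "\<lambda>e. \<Sum>k<Suc m. \<Sum>l<Suc m. rho m k l x x d e"])
qed

lemma integral_rho:
  "(LBINT y=ereal c..ereal d. (real (Suc m))\<^sup>2 * rho m 0 0 x x y y) = lnM_slope m x c d"
proof -
  have "(LBINT y=ereal c..ereal d. (real (Suc m))\<^sup>2 * rho m 0 0 x x y y) = lnM_slope m x c d - lnM_slope m x c c"
  proof (rule interval_integral_FTC_finite)
    show "continuous_on {min c d..max c d} (\<lambda>y. (real (Suc m))\<^sup>2 * rho m 0 0 x x y y)"
      by (rule continuous_on_subset[OF _ subset_UNIV]) (intro continuous_intros continuous_on_rho, auto)
  qed (use DERIV_lnM_slope in \<open>auto simp: has_real_derivative_iff_has_vector_derivative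
        intro: has_vector_derivative_at_within\<close>)
  \<comment> \<open>The boundary term at \<open>c\<close> vanishes, as each of its summands has the
    factor \<open>c - c\<close>.\<close>
  then show ?thesis by (simp add: lnM_slope_def)
qed

lemma integral_lnM_slope:
  "(LBINT x=ereal a..ereal b. lnM_slope m x c d) =
    lnM (Suc m) a c + lnM (Suc m) b d - lnM (Suc m) a d - lnM (Suc m) b c"
proof -
  have "(LBINT x=ereal a..ereal b. lnM_slope m x c d) =
      (lnM (Suc m) b d - lnM (Suc m) b c) - (lnM (Suc m) a d - lnM (Suc m) a c)"
  proof (rule interval_integral_FTC_finite)
    show "continuous_on {min a b..max a b} (\<lambda>x. lnM_slope m x c d)"
      unfolding lnM_slope_def
      by (rule continuous_on_subset[OF _ subset_UNIV]) (intro continuous_intros continuous_on_rho, auto)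
  qed (use DERIV_lnM_difference in \<open>auto simp: has_real_derivative_iff_has_vector_derivative
        intro: has_vector_derivative_at_within\<close>)
  then show ?thesis by simp
qed

end

section \<open>From the extensions to the functions tau\<close>

theorem proposition3p2:
  fixes u :: "real \<times> real \<Rightarrow> real"
    and M :: "nat \<Rightarrow> (nat \<Rightarrow> real) \<times> (nat \<Rightarrow> real) \<Rightarrow> real"
  assumes "continuous_on UNIV u"
    and "\<And>n. n \<ge> 1 \<Longrightarrow> is_positive_extension u n (M n)"
  shows "\<forall>n\<ge>1. \<forall>a b c d :: real.
    ln ((toda_tau M n a c * toda_tau M n b d) / (toda_tau M n a d * toda_tau M n b c)) =
    (LBINT x=ereal a..ereal b. (LBINT y=ereal c..ereal d.
       toda_tau M (n - 1) x y * toda_tau M (n + 1) x y / (toda_tau M n x y)\<^sup>2))"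
proof (intro allI impI)
  fix n :: nat and a b c d :: real
  assume "n \<ge> 1"
  then obtain m where n: "n = Suc m" by (cases n) auto
  \<comment> \<open>The hypothesis says nothing about \<open>M 0\<close>. The constant 1 is a
    positive extension for \<open>n = 0\<close> and agrees with \<open>toda_tau\<close>
    there.\<close>
  define N where "N = M(0 := \<lambda>_. 1)"
  interpret positive_extensions u N
  proof
    show "is_positive_extension u k (N k)" for k
      using assms(2)[of k] by (cases "k = 0") (auto simp: N_def is_positive_extension_def)
  qed
  define T where "T = (\<lambda>k x y. N k (scaled_ones k x, scaled_ones k y))"
  define s where "s = (\<lambda>k. superfactorial_const k powi (-2))"
  \<comment> \<open>This covers \<open>k = 0\<close> too, as \<open>s 0\<close> and
    \<open>T 0 x y\<close> are both 1.\<close>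
  have tau: "toda_tau M k x y = s k * T k x y" for k x y
    by (simp add: toda_tau_def N_def s_def T_def superfactorial_const_def)
  have s: "s k > 0" for k
    using superfactorial_const_pos[of k] by (simp add: s_def)
  have T: "T k x y > 0" for k x y
    \<comment> \<open>A multiple of the all-ones vector is a step vector with no coordinate moved,
      hence a point of the space.\<close>
    unfolding T_def using M_pos step_vector_in_topspace[of 0 k] by (simp add: step_vector_0)
  have "toda_tau M (n - 1) x y * toda_tau M (n + 1) x y / (toda_tau M n x y)\<^sup>2 =
      (real (Suc m))\<^sup>2 * rho m 0 0 x x y y" for x y
  proof -
    have "toda_tau M (n - 1) x y * toda_tau M (n + 1) x y / (toda_tau M n x y)\<^sup>2 =
        (s m * s (Suc (Suc m)) / (s (Suc m))\<^sup>2) * (T (Suc (Suc m)) x y * T m x y / (T (Suc m) x y)\<^sup>2)"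
      by (simp add: n tau power_mult_distrib)
    then show ?thesis
      unfolding s_def superfactorial_const_ratio T_def by (simp only: rho_const le0)
  qed
  moreover have "ln ((toda_tau M n a c * toda_tau M n b d) / (toda_tau M n a d * toda_tau M n b c)) =
      lnM (Suc m) a c + lnM (Suc m) b d - lnM (Suc m) a d - lnM (Suc m) b c"
  proof -
    have "T k x y \<noteq> 0" "s k \<noteq> 0" for k x y
      using T[of k x y] s[of k] by simp_all
    moreover have "lnM (Suc m) x y = ln (T (Suc m) x y)" for x y
      by (simp add: lnM_def T_def)
    ultimately show ?thesis
      unfolding tau n by (simp add: ln_div ln_mult T s)
  qed
  ultimately show "ln ((toda_tau M n a c * toda_tau M n b d) / (toda_tau M n a d * toda_tau M n b c)) =
    (LBINT x=ereal a..ereal b. (LBINT y=ereal c..ereal d.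
       toda_tau M (n - 1) x y * toda_tau M (n + 1) x y / (toda_tau M n x y)\<^sup>2))"
    by (simp only: integral_rho integral_lnM_slope)
qed

end
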